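(* For each $n$ let $x_1,\dots,x_n$ (with $x_j=x_{j,n}$ depending on $n$) be distinct points of $[-1,1]$, let $p_n(x)=\prod_{j=1}^n(x-x_j)$, let $W_{2n}(z)=2^nz^np_n\!\left(\frac{z+1/z}{2}\right)$, and let $z_j\in\mathbb{T}$ be such that $\frac{z_j+1/z_j}{2}=x_j$ for $j=1,\dots,n$. Assume that there exist positive constants $B$ and $L$ (independent of $n$ and $z$) such that for all $n$ large enough and every $z\in\mathbb{T}$, $$B\le\frac{|W_{2n}'(z)|}{2n},\qquad |W_{2n}(z)|^2\sum_{j=1}^n\left(\frac{1}{|z-z_j|^2}+\frac{1}{|z-\overline{z_j}|^2}\right)\le L(2n)^2 .$$ Let $f$ be a continuous function on $[-1,1]$ such that $\lambda(f,\delta)=o(\delta^{1/2})$ as $\delta\to0$. Let $l_{n-1}(f,x)$ be the Lagrange interpolation polynomial (of degree at most $n-1$) such that $l_{n-1}(f,x_j)=f(x_j)$ for $j=1,\dots,n$. Then $l_{n-1}(f,x)$ converges to $f(x)$ uniformly on $[-1,1]$ as $n\to\infty$.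
   Context: $\mathbb{T}=\{z\in\mathbb{C}:|z|=1\}$. The modulus of continuity of $f$ is $\lambda(f,\delta)=\sup\{|f(s)-f(t)|:s,t\in[-1,1],\ |s-t|<\delta\}$. The function $W_{2n}$ is a polynomial in $z$ of degree $2n$, namely $W_{2n}(z)=\prod_{j=1}^n(z-z_j)(z-\overline{z_j})$. Each term $|W_{2n}(z)|^2/|z-a|^2$ with $a$ a zero of $W_{2n}$ is understood as $|W_{2n}(z)/(z-a)|^2$, where $W_{2n}(z)/(z-a)$ is a polynomial. The function $f$ may be real- or complex-valued. *)

theory Defs
  imports "HOL-Analysis.Analysis" "HOL-Library.Landau_Symbols"
    "HOL-Computational_Algebra.Polynomial"
begin

definition modulus_of_continuity :: "(real \<Rightarrow> complex) \<Rightarrow> real \<Rightarrow> real" where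
  "modulus_of_continuity f \<delta> =
     Sup {cmod (f s - f t) | s t. s \<in> {-1..1} \<and> t \<in> {-1..1} \<and> \<bar>s - t\<bar> < \<delta>}"

text \<open>The functions \<open>x\<close> and \<open>w\<close> below are one row of the array of nodes, resp. of the array of
  points of the unit circle above the nodes; only the indices \<open>1, \<dots>, n\<close> are used.\<close>

definition node_poly :: "(nat \<Rightarrow> real) \<Rightarrow> nat \<Rightarrow> complex poly" where
  "node_poly x n = (\<Prod>j = 1..n. [:- complex_of_real (x j), 1:])"

definition W_poly :: "(nat \<Rightarrow> complex) \<Rightarrow> nat \<Rightarrow> complex poly" where
  "W_poly w n = (\<Prod>j = 1..n. [:- w j, 1:] * [:- cnj (w j), 1:])"

lemma poly_W_poly:
  assumes w: "\<And>j. j \<in> {1..n} \<Longrightarrow> cmod (w j) = 1 \<and> (w j + 1 / w j) / 2 = complex_of_real (x j)"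
    and z: "z \<noteq> 0"
  shows "poly (W_poly w n) z = 2 ^ n * z ^ n * poly (node_poly x n) ((z + 1 / z) / 2)"
proof -
  have factor: "(z - w j) * (z - cnj (w j)) = 2 * z * ((z + 1 / z) / 2 - complex_of_real (x j))"
    if "j \<in> {1..n}" for j
  proof -
    have "w j * cnj (w j) = 1"
      using w[OF that] by (simp add: complex_norm_square[symmetric])
    moreover from this have "1 / w j = cnj (w j)"
      by (metis mult_zero_left nonzero_mult_div_cancel_left zero_neq_one)
    moreover from this have "w j + cnj (w j) = 2 * complex_of_real (x j)"
      using w[OF that] by simp
    moreover have "2 * z * ((z + 1 / z) / 2 - complex_of_real (x j))
        = z * z + 1 - z * (2 * complex_of_real (x j))"
      using z by (simp add: field_simps)
    ultimately show ?thesis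
      by algebra
  qed
  have "poly (W_poly w n) z = (\<Prod>j = 1..n. (z - w j) * (z - cnj (w j)))"
    by (simp add: W_poly_def poly_prod algebra_simps)
  also have "\<dots> = (\<Prod>j = 1..n. 2 * z * ((z + 1 / z) / 2 - complex_of_real (x j)))"
    by (intro prod.cong refl factor)
  also have "\<dots> = 2 ^ n * z ^ n * poly (node_poly x n) ((z + 1 / z) / 2)"
    by (simp add: node_poly_def poly_prod prod.distrib power_mult_distrib)
  finally show ?thesis .
qed

text \<open>Where \<open>z\<close> equals a zero \<open>a\<close> of \<open>W\<close>, the quotient \<open>W(z)/(z - a)\<close> is read as the value of the
  polynomial \<open>W div [:- a, 1:]\<close>; the division is exact.\<close>

definition W_quot :: "(nat \<Rightarrow> complex) \<Rightarrow> nat \<Rightarrow> complex \<Rightarrow> complex poly" where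
  "W_quot w n a = W_poly w n div [:- a, 1:]"

lemma W_quot_mult:
  assumes "j \<in> {1..n}" and "a = w j \<or> a = cnj (w j)"
  shows "W_quot w n a * [:- a, 1:] = W_poly w n"
proof -
  have "[:- w j, 1:] * [:- cnj (w j), 1:] dvd W_poly w n"
    unfolding W_poly_def using assms(1) by (intro dvd_prodI) auto
  then have "[:- a, 1:] dvd W_poly w n"
    using assms(2) by (metis dvd_mult_left dvd_mult_right)
  then show ?thesis
    unfolding W_quot_def by (rule dvd_div_mult_self)
qed

end

theory Submission
  imports Defs
begin

text \<open>For \<open>t = Re \<zeta>\<close> with \<open>\<zeta>\<close> on the unit circle, the Lagrange basis polynomials satisfy
  \<open>\<bar>l\<^sub>j(t)\<bar> \<bar>W'(z\<^sub>j)\<bar> \<le> \<bar>W(\<zeta>)/(\<zeta> - z\<^sub>j)\<bar> + \<bar>W(\<zeta>)/(\<zeta> - cnj z\<^sub>j)\<bar>\<close>, so by Cauchy--Schwarz the two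
  hypotheses on \<open>W\<close> bound the Lebesgue constant by \<open>sqrt (2 n L) / B\<close>. Interpolation reproduces
  polynomials of degree less than \<open>n\<close>, and a function with modulus of continuity \<open>o(\<delta>\<^sup>1\<^sup>/\<^sup>2)\<close> is
  approximated by these up to \<open>o(n\<^sup>-\<^sup>1\<^sup>/\<^sup>2)\<close>, which beats the growth of the Lebesgue constant. The
  approximation is a discrete convolution, over roots of unity, with a Jackson-type kernel.\<close>

section \<open>Trigonometric sums on the unit circle\<close>

text \<open>The witness is the Chebyshev polynomial \<open>T_k\<close>, built by
  \<open>T_(k+2) = 2 t T_(k+1) - T_k\<close>; on the circle this recurrence is the real part of
  \<open>\<zeta>\<^sup>2 = 2 Re \<zeta> \<zeta> - 1\<close> multiplied by
  \<open>\<zeta> ^ k\<close>.\<close>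

lemma chebyshev_poly_ex:
  "\<exists>p :: complex poly. degree p \<le> k \<and>
     (\<forall>\<zeta>. cmod \<zeta> = 1 \<longrightarrow> poly p (of_real (Re \<zeta>)) = of_real (Re (\<zeta> ^ k)))"
proof (induction k rule: induct_nat_012)
  case 0
  show ?case by (rule exI[of _ 1]) auto
next
  case 1
  show ?case by (rule exI[of _ "[:0, 1:]"]) auto
next
  case (ge2 k)
  obtain p q :: "complex poly" where
    p: "degree p \<le> k" "\<And>\<zeta>. cmod \<zeta> = 1 \<Longrightarrow> poly p (of_real (Re \<zeta>)) = of_real (Re (\<zeta> ^ k))"
    and q: "degree q \<le> Suc k"
      "\<And>\<zeta>. cmod \<zeta> = 1 \<Longrightarrow> poly q (of_real (Re \<zeta>)) = of_real (Re (\<zeta> ^ Suc k))"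
    using ge2 by blast
  let ?r = "[:0, 2:] * q - p"
  have "degree ?r \<le> Suc (Suc k)"
    using p(1) q(1) degree_mult_le[of "[:0, 2:]" q] by (intro degree_diff_le) auto
  moreover have "poly ?r (of_real (Re \<zeta>)) = of_real (Re (\<zeta> ^ Suc (Suc k)))"
    if "cmod \<zeta> = 1" for \<zeta>
  proof -
    have "\<zeta> * cnj \<zeta> = 1"
      using that by (simp add: complex_norm_square[symmetric])
    moreover have "\<zeta> + cnj \<zeta> = of_real (2 * Re \<zeta>)"
      by (simp add: complex_add_cnj)
    ultimately have "\<zeta> * \<zeta> = of_real (2 * Re \<zeta>) * \<zeta> - 1"
      by algebra
    then have "(\<zeta> * \<zeta>) * \<zeta> ^ k = (of_real (2 * Re \<zeta>) * \<zeta> - 1) * \<zeta> ^ k"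
      by simp
    then have "\<zeta> ^ Suc (Suc k) = of_real (2 * Re \<zeta>) * \<zeta> ^ Suc k - \<zeta> ^ k"
      by (simp add: left_diff_distrib mult.assoc)
    then have "Re (\<zeta> ^ Suc (Suc k)) = 2 * Re \<zeta> * Re (\<zeta> ^ Suc k) - Re (\<zeta> ^ k)"
      by (simp only: minus_complex.sel Re_complex_of_real times_complex.sel Im_complex_of_real)
    then show ?thesis
      by (simp add: p(2)[OF that] q(2)[OF that] mult_ac del: power_Suc)
  qed
  ultimately show ?case by blast
qed

text \<open>Conjugation inverts \<open>w\<close> on the circle, and the real part does not see
  whether the remaining power is conjugated. With truncated subtraction,
  \<open>(k - l) + (l - k)\<close> is the distance between \<open>k\<close> and
  \<open>l\<close>.\<close>

lemma Re_power_mult_cnj_power: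
  assumes "cmod w = 1"
  shows "Re (w ^ k * cnj (w ^ l)) = Re (w ^ ((k - l) + (l - k)))"
proof -
  have *: "w ^ m * cnj (w ^ m) = 1" for m
    using complex_norm_square[of "w ^ m"] assms by (simp add: norm_power)
  show ?thesis
  proof (cases "k \<ge> l")
    case True
    then have "w ^ k = w ^ (k - l) * w ^ l" by (simp flip: power_add)
    then have "w ^ k * cnj (w ^ l) = w ^ (k - l)" using *[of l] by (simp add: mult.assoc)
    then show ?thesis using True by simp
  next
    case False
    then have "w ^ l = w ^ (l - k) * w ^ k" by (simp flip: power_add)
    then have "w ^ k * cnj (w ^ l) = cnj (w ^ (l - k)) * (w ^ k * cnj (w ^ k))" 
      by simp
    then have "w ^ k * cnj (w ^ l) = cnj (w ^ (l - k))" by (simp only: * mult_1_right)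
    then show ?thesis using False by (simp flip: complex_cnj_power)
  qed
qed

text \<open>This expansion into a cosine polynomial serves twice: summing it over roots of unity
  gives Parseval's identity, and replacing its cosines by Chebyshev polynomials makes the kernel
  algebraic.\<close>

lemma cmod_power_sum_square:
  fixes c :: "nat \<Rightarrow> real"
  assumes "cmod w = 1"
  shows "(cmod (\<Sum>k<d. of_real (c k) * w ^ k))\<^sup>2
    = (\<Sum>k<d. \<Sum>l<d. c k * c l * Re (w ^ ((k - l) + (l - k))))"
proof -
  let ?D = "\<Sum>k<d. of_real (c k) * w ^ k"
  have "of_real ((cmod ?D)\<^sup>2) = ?D * cnj ?D"
    by (rule complex_norm_square)
  also have "\<dots> = (\<Sum>k<d. \<Sum>l<d. of_real (c k * c l) * (w ^ k * cnj (w ^ l)))"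
    by (simp add: sum_product algebra_simps)
  finally have "(cmod ?D)\<^sup>2 = Re (\<Sum>k<d. \<Sum>l<d. of_real (c k * c l) * (w ^ k * cnj (w ^ l)))"
    by (metis Re_complex_of_real)
  also have "\<dots> = (\<Sum>k<d. \<Sum>l<d. c k * c l * Re (w ^ k * cnj (w ^ l)))"
    by (simp only: Re_sum Re_complex_of_real times_complex.sel(1) Im_complex_of_real) simp
  finally show ?thesis
    by (simp only: Re_power_mult_cnj_power[OF assms])
qed

text \<open>Up to the factor \<open>\<zeta> ^ i\<close> this is a geometric sum whose ratio
  \<open>q\<close> satisfies \<open>q ^ N = 1\<close>; the range of \<open>i\<close> ensures
  \<open>q \<noteq> 1\<close>.\<close>

lemma sum_rotated_roots_unity:
  fixes \<zeta> :: complex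
  assumes "0 < i" "i < N"
  shows "(\<Sum>j<N. (\<zeta> * cis (2 * pi * real j / real N)) ^ i) = 0"
proof -
  define q where "q = cis (2 * pi * real i / real N)"
  have pow: "cis (2 * pi * real j / real N) ^ i = q ^ j" for j
    by (simp add: q_def Complex.DeMoivre mult_ac)
  have "inj_on (\<lambda>k. cis (2 * pi * real k / real N)) {..<N}"
    using Complex.bij_betw_roots_unity[of N] assms by (auto simp: bij_betw_def)
  from inj_onD[OF this, of i 0] have "q \<noteq> 1"
    using assms by (auto simp: q_def)
  moreover have "q ^ N = 1"
    using assms cis_multiple_2pi[of "real i"] by (simp add: q_def Complex.DeMoivre)
  ultimately have "(\<Sum>j<N. q ^ j) = 0"
    by (simp add: sum_gp_strict)
  then show ?thesis
    by (simp add: power_mult_distrib pow flip: sum_distrib_left)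
qed

text \<open>Since \<open>d \<le> N\<close>, two exponents differ by less than \<open>N\<close>, so
  only the diagonal terms survive the sum over the roots of unity. The rotation by
  \<open>\<zeta>\<close> makes the value the same for every evaluation point.\<close>

lemma discrete_parseval:
  fixes c :: "nat \<Rightarrow> real"
  assumes "cmod \<zeta> = 1" "d \<le> N"
  shows "(\<Sum>j<N. (cmod (\<Sum>k<d. of_real (c k) * (\<zeta> * cis (2 * pi * real j / real N)) ^ k))\<^sup>2)
    = real N * (\<Sum>k<d. (c k)\<^sup>2)"
proof -
  define w where "w j = \<zeta> * cis (2 * pi * real j / real N)" for j
  have w: "cmod (w j) = 1" for j
    using assms by (simp add: w_def norm_mult)
  have ortho: "(\<Sum>j<N. Re (w j ^ ((k - l) + (l - k)))) = (if k = l then real N else 0)"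
    if "k < d" "l < d" for k l
  proof (cases "k = l")
    case False
    then have "0 < (k - l) + (l - k)" "(k - l) + (l - k) < N"
      using that assms by auto
    then show ?thesis
      using False sum_rotated_roots_unity[of "(k - l) + (l - k)" N \<zeta>]
      by (simp add: w_def flip: Re_sum)
  qed simp
  have "(\<Sum>j<N. (cmod (\<Sum>k<d. of_real (c k) * w j ^ k))\<^sup>2)
      = (\<Sum>j<N. \<Sum>k<d. \<Sum>l<d. c k * c l * Re (w j ^ ((k - l) + (l - k))))"
    by (simp only: cmod_power_sum_square[OF w])
  also have "\<dots> = (\<Sum>k<d. \<Sum>l<d. c k * c l * (\<Sum>j<N. Re (w j ^ ((k - l) + (l - k)))))"
    unfolding sum_distrib_left by (subst sum.swap, subst (2) sum.swap) simp
  also have "\<dots> = (\<Sum>k<d. \<Sum>l<d. c k * c l * (if k = l then real N else 0))"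
    by (intro sum.cong refl) (simp add: ortho)
  also have "\<dots> = real N * (\<Sum>k<d. (c k)\<^sup>2)"
    by (simp add: if_distrib sum_distrib_left power2_eq_square mult_ac cong: if_cong)
  finally show ?thesis
    by (simp add: w_def)
qed

text \<open>One squared modulus alone need not be even in the angle of \<open>\<zeta>\<close>.
  Adding the term with \<open>cnj \<zeta>\<close> leaves the products
  \<open>2 Re (\<eta> ^ m) Re (\<zeta> ^ m)\<close> with \<open>m \<le> d - 1\<close>, which are
  polynomials in \<open>Re \<zeta>\<close>.\<close>

lemma symmetrized_kernel_poly:
  fixes c :: "nat \<Rightarrow> real"
  assumes "cmod \<eta> = 1"
  shows "\<exists>p :: complex poly. degree p \<le> d - 1 \<and> (\<forall>\<zeta>. cmod \<zeta> = 1 \<longrightarrow>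
     poly p (of_real (Re \<zeta>)) = of_real ((cmod (\<Sum>k<d. of_real (c k) * (\<zeta> * \<eta>) ^ k))\<^sup>2
       + (cmod (\<Sum>k<d. of_real (c k) * (cnj \<zeta> * \<eta>) ^ k))\<^sup>2))"
proof -
  obtain T :: "nat \<Rightarrow> complex poly" where T: "\<And>k. degree (T k) \<le> k"
     "\<And>k \<zeta>. cmod \<zeta> = 1 \<Longrightarrow> poly (T k) (of_real (Re \<zeta>)) = of_real (Re (\<zeta> ^ k))"
    using chebyshev_poly_ex by metis
  define p where "p = (\<Sum>k<d. \<Sum>l<d.
    smult (of_real (c k * c l * (2 * Re (\<eta> ^ ((k - l) + (l - k)))))) (T ((k - l) + (l - k))))"
  have "degree p \<le> d - 1"
    unfolding p_def
    by (intro degree_sum_le) (auto intro!: order.trans[OF degree_smult_le] order.trans[OF T(1)])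
  moreover have "poly p (of_real (Re \<zeta>)) = of_real ((cmod (\<Sum>k<d. of_real (c k) * (\<zeta> * \<eta>) ^ k))\<^sup>2
       + (cmod (\<Sum>k<d. of_real (c k) * (cnj \<zeta> * \<eta>) ^ k))\<^sup>2)" if "cmod \<zeta> = 1" for \<zeta>
  proof -
    have "cmod (\<zeta> * \<eta>) = 1" "cmod (cnj \<zeta> * \<eta>) = 1"
      using that assms by (simp_all add: norm_mult)
    then have "(cmod (\<Sum>k<d. of_real (c k) * (\<zeta> * \<eta>) ^ k))\<^sup>2
       + (cmod (\<Sum>k<d. of_real (c k) * (cnj \<zeta> * \<eta>) ^ k))\<^sup>2
       = (\<Sum>k<d. \<Sum>l<d. c k * c l * (Re ((\<zeta> * \<eta>) ^ ((k - l) + (l - k)))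
            + Re ((cnj \<zeta> * \<eta>) ^ ((k - l) + (l - k)))))"
      by (simp only: cmod_power_sum_square distrib_left sum.distrib)
    also have "\<dots> = (\<Sum>k<d. \<Sum>l<d. c k * c l * (2 * Re (\<eta> ^ ((k - l) + (l - k))))
         * Re (\<zeta> ^ ((k - l) + (l - k))))"
      by (simp add: power_mult_distrib algebra_simps flip: complex_cnj_power)
    finally show ?thesis
      using T(2)[OF that] by (simp add: p_def poly_sum)
  qed
  ultimately show ?thesis by blast
qed

section \<open>Jackson-type approximation\<close>

lemma sum_squares_ge: "real M ^ 3 / 3 \<le> (\<Sum>k\<le>M. (real k)\<^sup>2)"
proof (induction M)
  case (Suc M)
  then show ?case by (simp add: power2_eq_square power3_eq_cube field_simps)
qed simp

text \<open>Summation by parts: the factor \<open>1 - w\<close> turns coefficients into their first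
  differences, with a boundary term at \<open>d\<close>. At \<open>k = 0\<close> truncated
  subtraction makes the difference 0, which is correct because \<open>b 0 = 0\<close>.\<close>

lemma sum_by_parts_times_one_minus:
  fixes b :: "nat \<Rightarrow> real" and w :: complex
  assumes "b 0 = 0"
  shows "(1 - w) * (\<Sum>k<d. of_real (b k) * w ^ k) + of_real (b d) * w ^ d
    = (\<Sum>k<Suc d. of_real (b k - b (k - 1)) * w ^ k)"
proof (induction d)
  case 0
  then show ?case using assms by simp
next
  case (Suc d)
  have "(1 - w) * (\<Sum>k<Suc d. of_real (b k) * w ^ k) + of_real (b (Suc d)) * w ^ Suc d
     = ((1 - w) * (\<Sum>k<d. of_real (b k) * w ^ k) + of_real (b d) * w ^ d)
       + of_real (b (Suc d) - b d) * w ^ Suc d"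
    by (simp add: algebra_simps)
  also have "\<dots> = (\<Sum>k<Suc (Suc d). of_real (b k - b (k - 1)) * w ^ k)"
    by (subst Suc.IH) simp
  finally show ?case .
qed

lemma unit_circle_above:
  assumes "t \<in> {-1..1}"
  obtains \<zeta> where "cmod \<zeta> = 1" "Re \<zeta> = t"
proof
  have "t\<^sup>2 \<le> 1"
    using assms by (simp add: abs_square_le_1 abs_le_iff)
  then show "cmod (Complex t (sqrt (1 - t\<^sup>2))) = 1"
    by (simp add: cmod_def)
qed simp

text \<open>The kernel is \<open>\<bar>D(\<zeta>\<eta>)\<bar>\<^sup>2\<close>, where \<open>D\<close> has the triangular coefficients \<open>b\<close>: since \<open>(1 - w) D(w)\<close> has
  coefficients of absolute value at most 1, its second moment over the roots of unity of order \<open>2M + 1\<close> is smaller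
  than its mass by a factor of order \<open>M\<^sup>2\<close>.\<close>

lemma jackson_approximation:
  fixes f :: "real \<Rightarrow> complex"
  assumes M: "M \<ge> 1" and \<beta>: "\<beta> \<ge> 0"
    and f: "\<And>s t. s \<in> {-1..1} \<Longrightarrow> t \<in> {-1..1} \<Longrightarrow> cmod (f s - f t) \<le> \<alpha> + \<beta> * (s - t)\<^sup>2"
  shows "\<exists>P. degree P \<le> 2 * M - 1 \<and>
    (\<forall>t\<in>{-1..1}. cmod (poly P (of_real t) - f t) \<le> \<alpha> + 9 * \<beta> / real M ^ 2)"
proof -
  \<comment> \<open>The coefficients rise to \<open>M\<close> and fall back to 0 at
    \<open>2 * M\<close>, which removes the boundary term. Then \<open>(1 - w) * D w\<close> has
    \<open>2 * M + 1\<close> coefficients, and \<open>N\<close> is just large enough for Parseval's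
    identity to apply to it.\<close>
  define b where "b k = real (min k (2 * M - k))" for k
  define N where "N = 2 * M + 1"
  define u where "u j = cis (2 * pi * real j / real N)" for j
  define D where "D w = (\<Sum>k<2*M. of_real (b k) * w ^ k)" for w :: complex
  define S where "S = (\<Sum>k<2*M. (b k)\<^sup>2)"
  have u: "cmod (u j) = 1" for j
    by (simp add: u_def)
  have N: "real N > 0" "real N \<le> 3 * real M"
    using M by (auto simp: N_def)
  \<comment> \<open>The rising half of the triangle already gives a mass of order
    \<open>M ^ 3\<close>.\<close>
  have "real M ^ 3 / 3 \<le> (\<Sum>k\<le>M. (b k)\<^sup>2)"
    using sum_squares_ge[of M] by (simp add: b_def)
  also have "\<dots> \<le> S"
    unfolding S_def using M by (intro sum_mono2) auto
  finally have S: "real M ^ 3 / 3 \<le> S" .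
  moreover have "real M ^ 3 > 0"
    using M by simp
  ultimately have "S > 0" by linarith
  have mass: "(\<Sum>j<N. (cmod (D (\<zeta> * u j)))\<^sup>2) = real N * S" if "cmod \<zeta> = 1" for \<zeta>
    unfolding D_def u_def S_def by (rule discrete_parseval) (use that in \<open>auto simp: N_def\<close>)
  have moment_eq: "(1 - w) * D w = (\<Sum>k<N. of_real (b k - b (k - 1)) * w ^ k)" for w
    using sum_by_parts_times_one_minus[of b w "2 * M"] by (simp add: b_def D_def N_def)
  have moment: "(\<Sum>j<N. (cmod ((1 - \<zeta> * u j) * D (\<zeta> * u j)))\<^sup>2) \<le> real N * real N"
    if "cmod \<zeta> = 1" for \<zeta>
  proof -
    have "(\<Sum>j<N. (cmod ((1 - \<zeta> * u j) * D (\<zeta> * u j)))\<^sup>2) = real N * (\<Sum>k<N. (b k - b (k - 1))\<^sup>2)"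
      unfolding moment_eq u_def by (rule discrete_parseval) (use that in auto)
    moreover have "(\<Sum>k<N. (b k - b (k - 1))\<^sup>2) \<le> (\<Sum>k<N. 1)"
    proof (rule sum_mono)
      fix k
      have "\<bar>b k - b (k - 1)\<bar> \<le> 1"
        unfolding b_def by linarith
      then show "(b k - b (k - 1))\<^sup>2 \<le> 1"
        by (simp add: abs_square_le_1)
    qed
    ultimately show ?thesis
      using N(1) by simp
  qed
  obtain p :: "nat \<Rightarrow> complex poly" where p: "\<And>j. degree (p j) \<le> 2 * M - 1"
    "\<And>j \<zeta>. cmod \<zeta> = 1 \<Longrightarrow> poly (p j) (of_real (Re \<zeta>))
        = of_real ((cmod (D (\<zeta> * u j)))\<^sup>2 + (cmod (D (cnj \<zeta> * u j)))\<^sup>2)"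
  proof -
    have "\<forall>j. \<exists>p :: complex poly. degree p \<le> 2 * M - 1 \<and> (\<forall>\<zeta>. cmod \<zeta> = 1 \<longrightarrow> poly p (of_real (Re \<zeta>))
        = of_real ((cmod (D (\<zeta> * u j)))\<^sup>2 + (cmod (D (cnj \<zeta> * u j)))\<^sup>2))"
      unfolding D_def by (intro allI symmetrized_kernel_poly u)
    from choice[OF this] show ?thesis
      using that by blast
  qed
  \<comment> \<open>A weighted mean of samples of \<open>f\<close>: the kernel at
    \<open>\<zeta>\<close> and the kernel at \<open>cnj \<zeta>\<close> each have total mass
    \<open>N * S\<close>, whence the normalization \<open>2 * N * S\<close>.\<close>
  define P where "P = (\<Sum>j<N. smult (f (Re (u j)) / of_real (2 * real N * S)) (p j))"
  have "degree P \<le> 2 * M - 1"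
    unfolding P_def by (intro degree_sum_le order.trans[OF degree_smult_le] p(1)) simp
  moreover have "cmod (poly P (of_real t) - f t) \<le> \<alpha> + 9 * \<beta> / real M ^ 2"
    if t: "t \<in> {-1..1}" for t
  proof -
    obtain \<zeta> where \<zeta>: "cmod \<zeta> = 1" "Re \<zeta> = t"
      using t by (rule unit_circle_above)
    define H where "H j = (cmod (D (\<zeta> * u j)))\<^sup>2 + (cmod (D (cnj \<zeta> * u j)))\<^sup>2" for j
    define T where "T = 2 * real N * S"
    have T: "T > 0" using N \<open>S > 0\<close> by (simp add: T_def)
    have H0: "H j \<ge> 0" for j
      by (simp add: H_def)
    have sumH: "(\<Sum>j<N. H j) = T"
      using mass[of \<zeta>] mass[of "cnj \<zeta>"] \<zeta> by (simp add: H_def sum.distrib T_def)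
    have pH: "poly (p j) (of_real t) = of_real (H j)" for j
      using p(2)[OF \<zeta>(1)] \<zeta>(2) by (simp add: H_def)
    have "f t = (\<Sum>j<N. of_real (H j / T) * f t)"
      using T sumH by (simp flip: sum_distrib_right of_real_sum sum_divide_distrib)
    moreover have "poly P (of_real t) = (\<Sum>j<N. of_real (H j / T) * f (Re (u j)))"
      by (simp add: P_def poly_sum pH T_def mult_ac)
    ultimately have "poly P (of_real t) - f t = (\<Sum>j<N. of_real (H j / T) * (f (Re (u j)) - f t))"
      by (simp only: sum_subtractf right_diff_distrib)
    also have "cmod \<dots> \<le> (\<Sum>j<N. H j / T * (\<alpha> + \<beta> * (Re (u j) - t)\<^sup>2))"
    proof (rule sum_norm_le)
      fix j
      have "Re (u j) \<in> {-1..1}"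
        using abs_Re_le_cmod[of "u j"] u[of j] by (simp add: abs_le_iff)
      from f[OF this t] show "cmod (of_real (H j / T) * (f (Re (u j)) - f t)) \<le> H j / T * (\<alpha> + \<beta> * (Re (u j) - t)\<^sup>2)"
        using H0[of j] T by (simp add: norm_mult norm_divide mult_left_mono divide_right_mono)
    qed
    also have "\<dots> = (\<Sum>j<N. H j) / T * \<alpha> + \<beta> / T * (\<Sum>j<N. H j * (Re (u j) - t)\<^sup>2)"
      by (simp add: sum_distrib_left sum_distrib_right sum_divide_distrib sum.distrib algebra_simps)
    also have "(\<Sum>j<N. H j) / T * \<alpha> = \<alpha>"
      using sumH T by simp
    also have "(\<Sum>j<N. H j * (Re (u j) - t)\<^sup>2) \<le> (\<Sum>j<N. (cmod ((1 - \<zeta> * u j) * D (\<zeta> * u j)))\<^sup>2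
        + (cmod ((1 - cnj \<zeta> * u j) * D (cnj \<zeta> * u j)))\<^sup>2)"
    proof (rule sum_mono)
      fix j
      \<comment> \<open>The kernel concentrates where \<open>u j\<close> is near
        \<open>cnj \<xi>\<close>, a point with real part \<open>t\<close>. The distance of the real
        parts is at most \<open>cmod (cnj \<xi> - u j)\<close>, which equals
        \<open>cmod (1 - \<xi> * u j)\<close>; so the second moment reduces to
        \<open>moment\<close>, for \<open>\<zeta>\<close> and for
        \<open>cnj \<zeta>\<close>.\<close>
      have dist: "(Re (u j) - t)\<^sup>2 \<le> (cmod (1 - \<xi> * u j))\<^sup>2" if "cmod \<xi> = 1" "Re \<xi> = t" for \<xi>
      proof -
        have "\<xi> * cnj \<xi> = 1"
          using that by (simp add: complex_norm_square[symmetric])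
        then have "1 - \<xi> * u j = \<xi> * (cnj \<xi> - u j)"
          by (simp add: algebra_simps)
        then have "cmod (1 - \<xi> * u j) = cmod (cnj \<xi> - u j)"
          using that by (simp add: norm_mult)
        moreover have "\<bar>Re (u j) - t\<bar> \<le> cmod (cnj \<xi> - u j)"
          using abs_Re_le_cmod[of "cnj \<xi> - u j"] that by (simp add: abs_minus_commute)
        ultimately show ?thesis
          by (metis abs_ge_zero power2_abs power_mono)
      qed
      show "H j * (Re (u j) - t)\<^sup>2 \<le> (cmod ((1 - \<zeta> * u j) * D (\<zeta> * u j)))\<^sup>2
        + (cmod ((1 - cnj \<zeta> * u j) * D (cnj \<zeta> * u j)))\<^sup>2"
        unfolding H_def distrib_right norm_mult power_mult_distrib
        using \<zeta> by (intro add_mono) (simp_all add: mult.commute[of "(cmod (D _))\<^sup>2"] mult_right_mono dist)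
    qed
    also have "\<dots> \<le> 2 * real N * real N"
      using moment[of \<zeta>] moment[of "cnj \<zeta>"] \<zeta> by (simp add: sum.distrib)
    finally have "cmod (poly P (of_real t) - f t) \<le> \<alpha> + \<beta> / T * (2 * real N * real N)"
      using \<beta> T by (simp add: mult_left_mono divide_right_mono)
    also have "\<beta> / T * (2 * real N * real N) = \<beta> * (real N / S)"
      using N \<open>S > 0\<close> by (simp add: T_def)
    \<comment> \<open>The constant 9 is 3 from \<open>N \<le> 3 * M\<close> times 3 from
      \<open>S \<ge> M ^ 3 / 3\<close>.\<close>
    also have "real N / S \<le> 3 * real M / (real M ^ 3 / 3)"
      using N S M by (intro frac_le) auto
    also have "\<dots> = 9 / real M ^ 2"
      using M by (simp add: field_simps power2_eq_square power3_eq_cube)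
    finally have "cmod (poly P (of_real t) - f t) \<le> \<alpha> + \<beta> * (9 / real M ^ 2)"
      using \<beta> by (simp add: mult_left_mono)
    then show ?thesis
      by (simp add: mult.commute)
  qed
  ultimately show ?thesis by blast
qed

section \<open>Functions whose modulus of continuity is small compared with the square root\<close>

text \<open>A real \<open>Sup\<close> dominates the members of its set only if the set is bounded
  above; continuity on a compact interval supplies this.\<close>

lemma modulus_of_continuity_upper:
  assumes "continuous_on {-1..1} f" "s \<in> {-1..1}" "t \<in> {-1..1}" "\<bar>s - t\<bar> < \<delta>"
  shows "cmod (f s - f t) \<le> modulus_of_continuity f \<delta>"
proof -
  have "bounded (f ` {-1..1})"
    using assms(1) by (intro compact_imp_bounded compact_continuous_image) auto
  then obtain F where F: "\<And>s. s \<in> {-1..1} \<Longrightarrow> cmod (f s) \<le> F"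
    unfolding bounded_iff by blast
  show ?thesis
    unfolding modulus_of_continuity_def
  proof (rule cSup_upper)
    show "bdd_above {cmod (f s - f t) |s t. s \<in> {-1..1} \<and> t \<in> {-1..1} \<and> \<bar>s - t\<bar> < \<delta>}"
      by (rule bdd_aboveI[of _ "F + F"]) (use F norm_triangle_le_diff add_mono in blast)
  qed (use assms in auto)
qed

text \<open>For close points the little-o bound applies; for points at distance at least
  \<open>d / 2\<close> the oscillation of \<open>f\<close> is bounded, and a large multiple of
  \<open>(s - t)\<^sup>2\<close> absorbs it.\<close>

lemma modulus_small_o_sqrt:
  assumes cont: "continuous_on {-1..1} f"
    and "modulus_of_continuity f \<in> o[at_right 0](\<lambda>\<delta>. \<delta> powr (1 / 2))"
    and "\<epsilon> > 0"
  obtains C where "C \<ge> 0"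
    "\<And>s t. s \<in> {-1..1} \<Longrightarrow> t \<in> {-1..1} \<Longrightarrow> cmod (f s - f t) \<le> \<epsilon> * sqrt \<bar>s - t\<bar> + C * (s - t)\<^sup>2"
proof -
  have "eventually (\<lambda>\<delta>. norm (modulus_of_continuity f \<delta>) \<le> (\<epsilon> / 2) * norm (\<delta> powr (1 / 2))) (at_right 0)"
    using landau_o.smallD[OF assms(2), of "\<epsilon> / 2"] assms(3) by simp
  then obtain d where d: "d > 0"
    "\<And>\<delta>. 0 < \<delta> \<Longrightarrow> \<delta> < d \<Longrightarrow> \<bar>modulus_of_continuity f \<delta>\<bar> \<le> (\<epsilon> / 2) * sqrt \<delta>"
    by (auto simp: eventually_at_right_field powr_half_sqrt)
  \<comment> \<open>Any two points of the interval are at distance at most 2, so the argument 3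
    covers all pairs.\<close>
  define F where "F = modulus_of_continuity f 3"
  have F: "cmod (f s - f t) \<le> F" if "s \<in> {-1..1}" "t \<in> {-1..1}" for s t
    unfolding F_def using that by (intro modulus_of_continuity_upper[OF cont]) auto
  have "F \<ge> 0"
    using F[of 0 0] by simp
  show thesis
  proof (rule that)
    show "F * (4 / d\<^sup>2) \<ge> 0"
      using \<open>F \<ge> 0\<close> by simp
    fix s t :: real
    assume st: "s \<in> {-1..1}" "t \<in> {-1..1}"
    show "cmod (f s - f t) \<le> \<epsilon> * sqrt \<bar>s - t\<bar> + F * (4 / d\<^sup>2) * (s - t)\<^sup>2"
    proof (cases "\<bar>s - t\<bar> < d / 2")
      case True
      have "cmod (f s - f t) \<le> \<epsilon> * sqrt \<bar>s - t\<bar>"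
      proof (cases "s = t")
        case False
        \<comment> \<open>The modulus uses a strict inequality, so it is taken at twice the
          distance, which is still below \<open>d\<close>. The halved \<open>\<epsilon>\<close> pays
          for the resulting factor \<open>sqrt 2\<close>.\<close>
        then have "cmod (f s - f t) \<le> modulus_of_continuity f (2 * \<bar>s - t\<bar>)"
          using st by (intro modulus_of_continuity_upper[OF cont]) auto
        also have "\<dots> \<le> \<epsilon> / 2 * sqrt (2 * \<bar>s - t\<bar>)"
          using d(2)[of "2 * \<bar>s - t\<bar>"] True False by auto
        also have "sqrt (2 * \<bar>s - t\<bar>) \<le> sqrt (4 * \<bar>s - t\<bar>)"
          by simp
        also have "\<dots> = 2 * sqrt \<bar>s - t\<bar>"
          by (simp add: real_sqrt_mult)
        finally show ?thesis
          using \<open>\<epsilon> > 0\<close> by simp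
      qed simp
      then show ?thesis
        using \<open>F \<ge> 0\<close> by (simp add: add_increasing2)
    next
      case False
      then have "(d / 2)\<^sup>2 \<le> \<bar>s - t\<bar>\<^sup>2"
        using d(1) by (intro power_mono) auto
      then have "1 \<le> (4 / d\<^sup>2) * (s - t)\<^sup>2"
        using d(1) by (simp add: field_simps)
      then have "F * 1 \<le> F * ((4 / d\<^sup>2) * (s - t)\<^sup>2)"
        using \<open>F \<ge> 0\<close> by (intro mult_left_mono)
      then have "cmod (f s - f t) \<le> F * (4 / d\<^sup>2) * (s - t)\<^sup>2"
        using F[OF st] by simp
      then show ?thesis
        using \<open>\<epsilon> > 0\<close> by (simp add: add_increasing)
    qed
  qed
qed

text \<open>At scale \<open>1 / M\<close>, the square root is majorized by a constant plus a
  quadratic, the form that \<open>jackson_approximation\<close> accepts.\<close>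

lemma jackson_small_o_sqrt:
  assumes cont: "continuous_on {-1..1} f"
    and modulus: "modulus_of_continuity f \<in> o[at_right 0](\<lambda>\<delta>. \<delta> powr (1 / 2))"
    and "\<epsilon> > 0"
  shows "eventually (\<lambda>M. \<exists>P. degree P \<le> 2 * M - 1 \<and>
    (\<forall>t\<in>{-1..1}. cmod (poly P (of_real t) - f t) \<le> \<epsilon> / sqrt (real M))) sequentially"
proof -
  \<comment> \<open>The square root part will contribute \<open>1 + 9 = 10\<close> times
    \<open>\<epsilon> / (20 * m)\<close>, half of the target; the other half is kept for
    \<open>C\<close>.\<close>
  obtain C where C: "C \<ge> 0" "\<And>s t. s \<in> {-1..1} \<Longrightarrow> t \<in> {-1..1} \<Longrightarrow>
      cmod (f s - f t) \<le> \<epsilon> / 20 * sqrt \<bar>s - t\<bar> + C * (s - t)\<^sup>2"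
    using modulus_small_o_sqrt[OF cont modulus, of "\<epsilon> / 20"] \<open>\<epsilon> > 0\<close> by auto
  \<comment> \<open>This threshold gives
    \<open>9 * C / M\<^sup>2 \<le> \<epsilon> / (2 * m)\<close>, as
    \<open>m \<le> M\<close>.\<close>
  have "eventually (\<lambda>M. real M \<ge> 1 + 18 * C / \<epsilon>) sequentially"
    using filterlim_real_sequentially by (simp add: filterlim_at_top)
  then show ?thesis
  proof eventually_elim
    case (elim M)
    have "18 * C / \<epsilon> \<ge> 0"
      using C(1) \<open>\<epsilon> > 0\<close> by simp
    then have M: "real M \<ge> 1" "M \<ge> 1" "18 * C / \<epsilon> \<le> real M"
      using elim by linarith+
    define m where "m = sqrt (real M)"
    have m: "m \<ge> 1" "m\<^sup>2 = real M"
      using M by (auto simp: m_def)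
    have f: "cmod (f s - f t) \<le> \<epsilon> / (20 * m) + (\<epsilon> / (20 * m) * real M ^ 2 + C) * (s - t)\<^sup>2"
      if "s \<in> {-1..1}" "t \<in> {-1..1}" for s t
    proof -
      define r where "r = sqrt \<bar>s - t\<bar>"
      have r: "r \<ge> 0" "r ^ 4 = (s - t)\<^sup>2"
      proof -
        have "r ^ 4 = (r\<^sup>2)\<^sup>2"
          by (simp flip: power_mult)
        then show "r ^ 4 = (s - t)\<^sup>2"
          by (simp add: r_def)
      qed (simp add: r_def)
      \<comment> \<open>The inequality \<open>y \<le> 1 + y ^ 4\<close> at
        \<open>y = sqrt (M * \<bar>s - t\<bar>)\<close>; its fourth power is quadratic in
        \<open>s - t\<close>.\<close>
      have "m * r \<le> 1 + (m * r) ^ 4"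
      proof (cases "m * r \<le> 1")
        case False
        then show ?thesis
          using power_increasing[of 1 4 "m * r"] by simp
      qed (simp add: add_increasing2)
      also have "(m * r) ^ 4 = real M ^ 2 * (s - t)\<^sup>2"
      proof -
        have "m ^ 4 = (m\<^sup>2)\<^sup>2"
          by (simp flip: power_mult)
        then show ?thesis
          by (simp add: power_mult_distrib m(2) r(2))
      qed
      finally have "r \<le> (1 + real M ^ 2 * (s - t)\<^sup>2) / m"
        using m(1) by (simp add: field_simps)
      then have "\<epsilon> / 20 * r \<le> \<epsilon> / 20 * ((1 + real M ^ 2 * (s - t)\<^sup>2) / m)"
        using \<open>\<epsilon> > 0\<close> by (intro mult_left_mono) auto
      also have "\<dots> = \<epsilon> / (20 * m) + \<epsilon> / (20 * m) * real M ^ 2 * (s - t)\<^sup>2"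
        by (simp add: add_divide_distrib distrib_left)
      finally show ?thesis
        using C(2)[OF that] by (simp add: r_def distrib_right)
    qed
    have "\<epsilon> / (20 * m) + 9 * (\<epsilon> / (20 * m) * real M ^ 2 + C) / real M ^ 2 = \<epsilon> / (2 * m) + 9 * C / real M ^ 2"
      using M(1) m(1) by (simp add: field_simps)
    also have "9 * C / real M ^ 2 \<le> \<epsilon> / (2 * m)"
    proof -
      have "m \<le> real M"
        using m by (metis mult_right_mono mult_1 power2_eq_square order.trans zero_le_one)
      then have "18 * C * m \<le> \<epsilon> * real M * real M"
        using M(1,3) m(1) \<open>\<epsilon> > 0\<close> by (intro mult_mono[of "18 * C" "\<epsilon> * real M"]) (auto simp: field_simps)
      then show ?thesis
        using M(1) m(1) by (simp add: field_simps power2_eq_square)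
    qed
    finally have le: "\<epsilon> / (20 * m) + 9 * (\<epsilon> / (20 * m) * real M ^ 2 + C) / real M ^ 2 \<le> \<epsilon> / m"
      by (simp add: field_simps)
    have "\<epsilon> / (20 * m) * real M ^ 2 + C \<ge> 0"
      using \<open>\<epsilon> > 0\<close> C(1) m(1) by simp
    from jackson_approximation[OF M(2) this f] le show ?case
      unfolding m_def by (meson order.trans)
  qed
qed

section \<open>Lagrange interpolation and the Lebesgue constant\<close>

text \<open>Both sides are polynomials in \<open>y\<close> of degree less than
  \<open>card A\<close>, and they agree at the \<open>card A\<close> nodes.\<close>

lemma lagrange_interpolation:
  fixes a :: "'i \<Rightarrow> 'a :: field" and q :: "'a poly"
  assumes "finite A" "inj_on a A" "degree q < card A"
  shows "poly q y = (\<Sum>j\<in>A. poly q (a j) * (\<Prod>i\<in>A - {j}. (y - a i) / (a j - a i)))"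
proof -
  define r where "r = (\<Sum>j\<in>A. smult (poly q (a j) / (\<Prod>i\<in>A - {j}. a j - a i)) (\<Prod>i\<in>A - {j}. [:- a i, 1:]))"
  have poly_r: "poly r y = (\<Sum>j\<in>A. poly q (a j) * (\<Prod>i\<in>A - {j}. (y - a i) / (a j - a i)))" for y
    by (simp add: r_def poly_sum poly_prod prod_dividef)
  have "q = r"
  proof (rule poly_eqI_degree[of "a ` A"])
    fix y assume "y \<in> a ` A"
    then obtain k where k: "k \<in> A" "y = a k" by blast
    have "poly r y = (\<Sum>j\<in>A. if j = k then poly q (a k) else 0)"
      unfolding poly_r
    proof (rule sum.cong)
      fix j assume j: "j \<in> A"
      show "poly q (a j) * (\<Prod>i\<in>A - {j}. (y - a i) / (a j - a i)) = (if j = k then poly q (a k) else 0)"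
      proof (cases "j = k")
        case True
        then have "(\<Prod>i\<in>A - {j}. (y - a i) / (a j - a i)) = 1"
          using k assms(2) by (intro prod.neutral) (auto simp: inj_on_def)
        then show ?thesis using True by simp
      next
        case False
        then have "(\<Prod>i\<in>A - {j}. (y - a i) / (a j - a i)) = 0"
          using k assms(1) by (intro prod_zero) auto
        then show ?thesis using False by simp
      qed
    qed simp
    also have "\<dots> = poly q y"
      using k assms(1) by simp
    finally show "poly q y = poly r y" ..
  next
    show "degree q < card (a ` A)"
      using assms by (simp add: card_image)
    have "degree r \<le> card A - 1"
      unfolding r_def
    proof (intro degree_sum_le assms order.trans[OF degree_smult_le])
      fix j assume "j \<in> A"
      have "degree (\<Prod>i\<in>A - {j}. [:- a i, 1:]) \<le> (\<Sum>i\<in>A - {j}. degree [:- a i, 1:])"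
        using degree_prod_sum_le[of "A - {j}" "\<lambda>i. [:- a i, 1:]"] assms(1) by (simp add: comp_def)
      then show "degree (\<Prod>i\<in>A - {j}. [:- a i, 1:]) \<le> card A - 1"
        using assms(1) \<open>j \<in> A\<close> by simp
    qed
    then show "degree r < card (a ` A)"
      using assms by (simp add: card_image)
  qed
  then have "poly q y = poly r y"
    by (rule arg_cong)
  also note poly_r
  finally show ?thesis .
qed

text \<open>On the circle \<open>(\<zeta> - w) * (\<zeta> - cnj w) = 2 * \<zeta> * (Re \<zeta> - Re
  w)\<close>. This translates between factors of \<open>W\<close> and differences of nodes.\<close>

lemma cmod_mult_diff_unit_circle:
  assumes "cmod \<zeta> = 1" "cmod w = 1"
  shows "cmod (\<zeta> - w) * cmod (\<zeta> - cnj w) = 2 * \<bar>Re \<zeta> - Re w\<bar>"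
proof -
  have "\<zeta> * cnj \<zeta> = 1" "w * cnj w = 1"
    using assms by (simp_all add: complex_norm_square[symmetric])
  moreover have "\<zeta> + cnj \<zeta> = of_real (2 * Re \<zeta>)" "w + cnj w = of_real (2 * Re w)"
    by (simp_all add: complex_add_cnj)
  ultimately have "(\<zeta> - w) * (\<zeta> - cnj w) = \<zeta> * (of_real (2 * Re \<zeta>) - of_real (2 * Re w))"
    by algebra
  also have "\<dots> = \<zeta> * of_real (2 * (Re \<zeta> - Re w))"
    by simp
  finally have "cmod (\<zeta> - w) * cmod (\<zeta> - cnj w) = cmod (\<zeta> * of_real (2 * (Re \<zeta> - Re w)))"
    by (simp only: norm_mult[symmetric])
  then show ?thesis
    unfolding norm_mult[of \<zeta>] norm_of_real assms(1) abs_mult by simp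
qed

text \<open>With \<open>R\<close> the product over \<open>i \<noteq> j\<close>, the two quotients at \<open>\<zeta>\<close> are \<open>(\<zeta> - cnj w\<^sub>j) R\<close> and
  \<open>(\<zeta> - w\<^sub>j) R\<close>, while \<open>W'(w\<^sub>j) = (w\<^sub>j - cnj w\<^sub>j) R(w\<^sub>j)\<close>; the triangle inequality for
  \<open>w\<^sub>j - cnj w\<^sub>j\<close> does the rest.\<close>

lemma lagrange_basis_le_W_quot:
  assumes w: "\<And>i. i \<in> {1..n} \<Longrightarrow> cmod (w i) = 1"
    and inj: "inj_on (\<lambda>i. Re (w i)) {1..n}"
    and j: "j \<in> {1..n}" and \<zeta>: "cmod \<zeta> = 1"
  shows "(\<Prod>i\<in>{1..n} - {j}. \<bar>Re \<zeta> - Re (w i)\<bar> / \<bar>Re (w j) - Re (w i)\<bar>)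
        * cmod (poly (pderiv (W_poly w n)) (w j))
      \<le> cmod (poly (W_quot w n (w j)) \<zeta>) + cmod (poly (W_quot w n (cnj (w j))) \<zeta>)"
proof -
  define R where "R = (\<Prod>i\<in>{1..n} - {j}. [:- w i, 1:] * [:- cnj (w i), 1:])"
  have W: "W_poly w n = [:- w j, 1:] * ([:- cnj (w j), 1:] * R)"
    unfolding W_poly_def R_def by (subst prod.remove[OF _ j]) (simp_all only: mult.assoc finite_atLeastAtMost)
  have Q1: "W_quot w n (w j) = [:- cnj (w j), 1:] * R"
    unfolding W_quot_def W by (rule nonzero_mult_div_cancel_left) simp
  have Q2: "W_quot w n (cnj (w j)) = [:- w j, 1:] * R"
    unfolding W_quot_def W mult.left_commute[of "[:- w j, 1:]"]
    by (rule nonzero_mult_div_cancel_left) simp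
  have W': "poly (pderiv (W_poly w n)) (w j) = (w j - cnj (w j)) * poly R (w j)"
    unfolding W pderiv_mult[of "[:- w j, 1:]"] poly_add poly_mult by (simp add: pderiv_pCons)
  \<comment> \<open>Each conjugate pair contributes twice a node difference, so the quotient of
    \<open>cmod (poly R \<zeta>)\<close> by \<open>cmod (poly R (w j))\<close> is the modulus of the
    Lagrange basis polynomial, the factors 2 cancelling.\<close>
  have R: "cmod (poly R \<xi>) = (\<Prod>i\<in>{1..n} - {j}. 2 * \<bar>Re \<xi> - Re (w i)\<bar>)" if "cmod \<xi> = 1" for \<xi>
    unfolding R_def poly_prod prod_norm[symmetric]
  proof (rule prod.cong)
    fix i assume "i \<in> {1..n} - {j}"
    then have "cmod (\<xi> - w i) * cmod (\<xi> - cnj (w i)) = 2 * \<bar>Re \<xi> - Re (w i)\<bar>"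
      using that w by (intro cmod_mult_diff_unit_circle) auto
    then show "cmod (poly ([:- w i, 1:] * [:- cnj (w i), 1:]) \<xi>) = 2 * \<bar>Re \<xi> - Re (w i)\<bar>"
      by (simp only: poly_mult norm_mult) simp
  qed simp
  have "Re (w j) - Re (w i) \<noteq> 0" if "i \<in> {1..n} - {j}" for i
    using inj_onD[OF inj, of j i] j that by auto
  then have R0: "cmod (poly R (w j)) \<noteq> 0"
    using R[OF w[OF j]] by (simp add: prod_zero_iff)
  have "(\<Prod>i\<in>{1..n} - {j}. \<bar>Re \<zeta> - Re (w i)\<bar> / \<bar>Re (w j) - Re (w i)\<bar>)
      = (\<Prod>i\<in>{1..n} - {j}. (2 * \<bar>Re \<zeta> - Re (w i)\<bar>) / (2 * \<bar>Re (w j) - Re (w i)\<bar>))"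
    by simp
  also have "\<dots> = cmod (poly R \<zeta>) / cmod (poly R (w j))"
    unfolding R[OF \<zeta>] R[OF w[OF j]] by (rule prod_dividef)
  finally have "(\<Prod>i\<in>{1..n} - {j}. \<bar>Re \<zeta> - Re (w i)\<bar> / \<bar>Re (w j) - Re (w i)\<bar>)
        * cmod (poly (pderiv (W_poly w n)) (w j)) = cmod (w j - cnj (w j)) * cmod (poly R \<zeta>)"
    using R0 by (simp add: W' norm_mult)
  also have "\<dots> \<le> (cmod (\<zeta> - cnj (w j)) + cmod (\<zeta> - w j)) * cmod (poly R \<zeta>)"
    using norm_triangle_ineq4[of "\<zeta> - cnj (w j)" "\<zeta> - w j"] by (intro mult_right_mono) auto
  also have "\<dots> = cmod (poly (W_quot w n (w j)) \<zeta>) + cmod (poly (W_quot w n (cnj (w j))) \<zeta>)"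
    unfolding Q1 Q2 poly_mult norm_mult distrib_right by simp
  finally show ?thesis .
qed

text \<open>Cauchy-Schwarz for the \<open>2 * card A\<close> numbers \<open>a j\<close> and
  \<open>b j\<close>.\<close>

lemma sum_add_le_sqrt:
  fixes a b :: "'i \<Rightarrow> real"
  assumes "(\<Sum>j\<in>A. (a j)\<^sup>2 + (b j)\<^sup>2) \<le> K"
  shows "(\<Sum>j\<in>A. a j + b j) \<le> sqrt (2 * real (card A) * K)"
proof (rule real_le_rsqrt)
  have "(\<Sum>j\<in>A. a j + b j)\<^sup>2 \<le> real (card A) * (\<Sum>j\<in>A. (a j + b j)\<^sup>2)"
    using sum_squared_le_sum_of_squares[of "\<lambda>j. a j + b j" A] by (simp add: mult.commute)
  also have "\<dots> \<le> real (card A) * (\<Sum>j\<in>A. 2 * ((a j)\<^sup>2 + (b j)\<^sup>2))"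
  proof (intro mult_left_mono sum_mono)
    show "(a j + b j)\<^sup>2 \<le> 2 * ((a j)\<^sup>2 + (b j)\<^sup>2)" for j
      using sum_squares_bound[of "a j" "b j"] by (simp add: power2_sum)
  qed simp
  also have "\<dots> = 2 * real (card A) * (\<Sum>j\<in>A. (a j)\<^sup>2 + (b j)\<^sup>2)"
    by (subst sum_distrib_left[symmetric]) (simp only: mult_ac)
  also have "\<dots> \<le> 2 * real (card A) * K"
    using assms by (intro mult_left_mono) auto
  finally show "(\<Sum>j\<in>A. a j + b j)\<^sup>2 \<le> 2 * real (card A) * K" .
qed

text \<open>The bound on the Lebesgue constant, stated as stability: Cauchy-Schwarz bounds the sum
  of all quotients by \<open>sqrt (2 * n * L) * (2 * n)\<close>, and the lower bound for the
  derivative, used at the points \<open>w j\<close> only, divides this by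
  \<open>2 * n * B\<close>.\<close>

lemma interpolation_bound:
  assumes n: "n \<ge> 1" and w: "\<And>i. i \<in> {1..n} \<Longrightarrow> cmod (w i) = 1"
    and inj: "inj_on (\<lambda>i. Re (w i)) {1..n}"
    and B: "B > 0" and L: "L > 0"
    and deriv: "\<And>\<zeta>. cmod \<zeta> = 1 \<Longrightarrow> B \<le> cmod (poly (pderiv (W_poly w n)) \<zeta>) / (2 * real n)"
    and quot: "\<And>\<zeta>. cmod \<zeta> = 1 \<Longrightarrow> (\<Sum>j = 1..n. (cmod (poly (W_quot w n (w j)) \<zeta>))\<^sup>2
                    + (cmod (poly (W_quot w n (cnj (w j))) \<zeta>))\<^sup>2) \<le> L * (2 * real n)\<^sup>2"
    and q: "degree q \<le> n - 1"
      "\<And>j. j \<in> {1..n} \<Longrightarrow> cmod (poly q (of_real (Re (w j)))) \<le> E"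
    and t: "t \<in> {-1..1}"
  shows "cmod (poly q (of_real t)) \<le> sqrt (2 * real n * L) / B * E"
proof -
  obtain \<zeta> where \<zeta>: "cmod \<zeta> = 1" "Re \<zeta> = t"
    using t by (rule unit_circle_above)
  have "E \<ge> 0"
    using q(2)[of 1] n by (meson atLeastAtMost_iff norm_ge_zero order.refl order.trans)
  define Q where "Q j = cmod (poly (W_quot w n (w j)) \<zeta>) + cmod (poly (W_quot w n (cnj (w j))) \<zeta>)" for j
  define l where "l j = (\<Prod>i\<in>{1..n} - {j}. \<bar>t - Re (w i)\<bar> / \<bar>Re (w j) - Re (w i)\<bar>)" for j
  have l0: "l j \<ge> 0" for j
    unfolding l_def by (intro prod_nonneg) auto
  have l: "l j \<le> Q j / (2 * real n * B)" if j: "j \<in> {1..n}" for j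
  proof -
    have "2 * real n * B \<le> cmod (poly (pderiv (W_poly w n)) (w j))"
      using deriv[OF w[OF j]] n by (simp add: field_simps)
    then have "l j * (2 * real n * B) \<le> l j * cmod (poly (pderiv (W_poly w n)) (w j))"
      using l0 by (rule mult_left_mono)
    also have "\<dots> \<le> Q j"
      using lagrange_basis_le_W_quot[OF w inj j \<zeta>(1)] by (simp add: l_def Q_def \<zeta>(2))
    finally show ?thesis
      using n B by (simp add: field_simps)
  qed
  have inj': "inj_on (\<lambda>i. complex_of_real (Re (w i))) {1..n}"
    using inj unfolding inj_on_def of_real_eq_iff .
  have "poly q (of_real t) = (\<Sum>j\<in>{1..n}. poly q (of_real (Re (w j)))
      * (\<Prod>i\<in>{1..n} - {j}. (of_real t - of_real (Re (w i))) / (of_real (Re (w j)) - of_real (Re (w i)))))"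
  proof (rule lagrange_interpolation[OF _ inj'])
    show "degree q < card {1..n}"
      using q(1) n by simp
  qed simp
  also have "cmod \<dots> \<le> (\<Sum>j\<in>{1..n}. E * (Q j / (2 * real n * B)))"
  proof (rule sum_norm_le)
    fix j assume j: "j \<in> {1..n}"
    have X: "cmod (\<Prod>i\<in>{1..n} - {j}. (of_real t - of_real (Re (w i))) / (of_real (Re (w j)) - of_real (Re (w i)))) = l j"
      unfolding l_def by (simp only: prod_norm[symmetric] of_real_diff[symmetric] of_real_divide[symmetric] norm_of_real abs_divide)
    show "cmod (poly q (of_real (Re (w j)))
      * (\<Prod>i\<in>{1..n} - {j}. (of_real t - of_real (Re (w i))) / (of_real (Re (w j)) - of_real (Re (w i)))))
      \<le> E * (Q j / (2 * real n * B))"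
      unfolding norm_mult X by (intro mult_mono q(2) l j l0 \<open>E \<ge> 0\<close>)
  qed
  also have "\<dots> = E * ((\<Sum>j = 1..n. Q j) / (2 * real n * B))"
    by (simp add: sum_distrib_left sum_divide_distrib)
  also have "(\<Sum>j = 1..n. Q j) \<le> sqrt (2 * real n * (L * (2 * real n)\<^sup>2))"
    using sum_add_le_sqrt[OF quot[OF \<zeta>(1)]] by (simp add: Q_def)
  also have "\<dots> = sqrt (2 * real n * L) * (2 * real n)"
    unfolding mult.assoc[symmetric] real_sqrt_mult[of _ "(2 * real n)\<^sup>2"] real_sqrt_abs by simp
  finally have "cmod (poly q (of_real t)) \<le> E * (sqrt (2 * real n * L) * (2 * real n) / (2 * real n * B))"
    using \<open>E \<ge> 0\<close> B by (simp add: mult_left_mono divide_right_mono)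
  then show ?thesis
    using n B by (simp add: mult_ac)
qed

section \<open>Uniform convergence of the interpolants\<close>

theorem theorem4:
  fixes x :: "nat \<Rightarrow> nat \<Rightarrow> real" and z :: "nat \<Rightarrow> nat \<Rightarrow> complex"
    and f :: "real \<Rightarrow> complex" and l :: "nat \<Rightarrow> complex poly" and B L :: real
  assumes nodes: "\<And>n j. j \<in> {1..n} \<Longrightarrow> x n j \<in> {-1..1}"
    and distinct_nodes: "\<And>n. inj_on (x n) {1..n}"
    and circle_points: "\<And>n j. j \<in> {1..n} \<Longrightarrow>
          cmod (z n j) = 1 \<and> (z n j + 1 / z n j) / 2 = complex_of_real (x n j)"
    and "B > 0" and "L > 0"
    and bounds: "eventually (\<lambda>n. \<forall>\<zeta>. cmod \<zeta> = 1 \<longrightarrow>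
          B \<le> cmod (poly (pderiv (W_poly (z n) n)) \<zeta>) / (2 * real n) \<and>
          (\<Sum>j = 1..n. (cmod (poly (W_quot (z n) n (z n j)) \<zeta>))\<^sup>2
                    + (cmod (poly (W_quot (z n) n (cnj (z n j))) \<zeta>))\<^sup>2)
            \<le> L * (2 * real n)\<^sup>2) sequentially"
    and cont: "continuous_on {-1..1} f"
    and modulus: "modulus_of_continuity f \<in> o[at_right 0](\<lambda>\<delta>. \<delta> powr (1 / 2))"
    and degree_l: "\<And>n. n \<ge> 1 \<Longrightarrow> degree (l n) \<le> n - 1"
    and interpolates: "\<And>n j. j \<in> {1..n} \<Longrightarrow>
          poly (l n) (complex_of_real (x n j)) = f (x n j)"
  shows "uniform_limit {-1..1} (\<lambda>n t. poly (l n) (complex_of_real t)) f sequentially"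
proof (rule uniform_limitI)
  fix e :: real
  assume "e > 0"
  \<comment> \<open>With \<open>n \<le> 3 * M\<close> the Lebesgue bound
    \<open>sqrt (2 * n * L) / B\<close> is at most \<open>sqrt (6 * L) / B * sqrt M\<close>; the
    summand 1 pays for the error of \<open>P\<close> itself. The choice of \<open>\<epsilon>\<close>
    then makes the total \<open>e / 2\<close>.\<close>
  define K where "K = sqrt (6 * L) / B + 1"
  have "sqrt (6 * L) / B \<ge> 0"
    using \<open>B > 0\<close> \<open>L > 0\<close> by simp
  then have "K > 0"
    unfolding K_def by linarith
  define \<epsilon> where "\<epsilon> = e / (2 * K)"
  have "\<epsilon> > 0"
    using \<open>e > 0\<close> \<open>K > 0\<close> by (simp add: \<epsilon>_def)
  have Re_z: "Re (z n j) = x n j" if "j \<in> {1..n}" for n j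
  proof -
    have "1 / z n j = cnj (z n j)"
      using circle_points[OF that] by (simp add: complex_div_cnj[of 1])
    then have "(z n j + cnj (z n j)) / 2 = of_real (x n j)"
      using circle_points[OF that] by simp
    from arg_cong[OF this, of Re] show ?thesis
      by simp
  qed
  \<comment> \<open>Taking \<open>M = n div 2\<close> keeps the degree \<open>2 * M - 1\<close> of
    the approximant within \<open>n - 1\<close>, where interpolation is exact;
    \<open>n \<ge> 2\<close> gives \<open>M \<ge> 1\<close> and
    \<open>n \<le> 3 * M\<close>.\<close>
  have "filterlim (\<lambda>n. n div 2) at_top (sequentially :: nat filter)"
    by (rule filterlim_at_top_div_const_nat) simp
  from eventually_compose_filterlim[OF jackson_small_o_sqrt[OF cont modulus \<open>\<epsilon> > 0\<close>] this]
  have approx: "eventually (\<lambda>n. \<exists>P. degree P \<le> 2 * (n div 2) - 1 \<and> (\<forall>t\<in>{-1..1}.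
      cmod (poly P (of_real t) - f t) \<le> \<epsilon> / sqrt (real (n div 2)))) sequentially" .
  show "\<forall>\<^sub>F n in sequentially. \<forall>t\<in>{-1..1}. dist (poly (l n) (complex_of_real t)) (f t) < e"
    using approx bounds eventually_ge_at_top[of "2 :: nat"]
  proof eventually_elim
    case (elim n)
    define M where "M = n div 2"
    define E where "E = \<epsilon> / sqrt (real M)"
    have "M \<ge> 1" "n \<le> 3 * M" "2 * M - 1 \<le> n - 1"
      using elim(3) unfolding M_def by arith+
    then have M: "real M \<ge> 1" "real n \<le> 3 * real M" "2 * M - 1 \<le> n - 1"
      by linarith+
    obtain P where P: "degree P \<le> 2 * M - 1"
      "\<And>t. t \<in> {-1..1} \<Longrightarrow> cmod (poly P (of_real t) - f t) \<le> E"
      using elim(1) unfolding M_def E_def by blast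
    show ?case
    proof
      fix t :: real
      assume t: "t \<in> {-1..1}"
      \<comment> \<open>At the nodes \<open>l n - P\<close> equals \<open>f - P\<close>, hence is at
        most \<open>E\<close> there; stability carries this to all of the interval.\<close>
      have "cmod (poly (l n - P) (of_real t)) \<le> sqrt (2 * real n * L) / B * E"
      proof (rule interpolation_bound[where w = "z n" and n = n])
        show "inj_on (\<lambda>i. Re (z n i)) {1..n}"
          using distinct_nodes[of n] by (subst inj_on_cong[of _ _ "x n"]) (auto simp: Re_z)
        show "degree (l n - P) \<le> n - 1"
          using P(1) M(3) degree_l[of n] elim(3) by (intro degree_diff_le) auto
        show "cmod (poly (l n - P) (of_real (Re (z n j)))) \<le> E" if "j \<in> {1..n}" for j
          using P(2)[OF nodes[OF that]] interpolates[OF that] that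
          by (simp add: Re_z norm_minus_commute)
      qed (use elim circle_points \<open>B > 0\<close> \<open>L > 0\<close> t in auto)
      moreover have "dist (poly (l n) (of_real t)) (f t)
          \<le> cmod (poly (l n - P) (of_real t)) + cmod (poly P (of_real t) - f t)"
        using norm_triangle_ineq[of "poly (l n - P) (of_real t)" "poly P (of_real t) - f t"]
        by (simp add: dist_norm)
      ultimately have "dist (poly (l n) (of_real t)) (f t) \<le> (sqrt (2 * real n * L) / B + 1) * E"
        using P(2)[OF t] by (simp add: algebra_simps)
      also have "\<dots> \<le> (K * sqrt (real M)) * E"
      proof (rule mult_right_mono)
        have "sqrt (2 * real n * L) \<le> sqrt (6 * L * real M)"
          using M(2) \<open>L > 0\<close> by simp
        then have "sqrt (2 * real n * L) / B \<le> sqrt (6 * L) / B * sqrt (real M)"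
          using \<open>B > 0\<close> by (simp add: real_sqrt_mult divide_right_mono)
        then show "sqrt (2 * real n * L) / B + 1 \<le> K * sqrt (real M)"
          using M(1) by (simp add: K_def distrib_right add_mono)
        show "E \<ge> 0"
          using \<open>\<epsilon> > 0\<close> by (simp add: E_def)
      qed
      also have "\<dots> = e / 2"
        using M(1) \<open>K > 0\<close> by (simp add: E_def \<epsilon>_def)
      finally show "dist (poly (l n) (of_real t)) (f t) < e"
        using \<open>e > 0\<close> by simp
    qed
  qed
qed

end
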